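(* For every $t\in[0,d]$ (and every realisation of $\xi$), $$\|A(\widehat f_t-f)\|^2=A_{t,\lambda}+S_{t,\lambda}-2\langle\xi,r_{t,>}(AA^\top)Y\rangle\le2(A_{t,\lambda}+S_{t,\lambda}).$$
   Context: Model: $D\ge 3$ and $P\ge D$ are integers, $A\in\mathbb{R}^{D\times P}$ has rank $D$, $f\in\mathbb{R}^P$, $g=Af$, $\xi\in\mathbb{R}^D$ is an arbitrary error vector, and $Y=g+\xi$. $\|\cdot\|$ and $\langle\cdot,\cdot\rangle$ are Euclidean norm and inner product, $A^\dagger=A^\top(AA^\top)^{-1}$. Let $\lambda_1\ge\dots\ge\lambda_D>0$ be the nonzero singular values of $A$ (with multiplicity), $u_i$ the left singular vectors, $\tilde\lambda_1>\dots>\tilde\lambda_d>0$ the distinct singular values. Put $Y_i=\langle Y,u_i\rangle$. For a function $h$ on $[0,\infty)$ and $w\in\mathbb{R}^D$, $h(AA^\top)w=\sum_{i=1}^D h(\lambda_i^2)\langle w,u_i\rangle u_i$. Standing assumption: $\sum_{j:\lambda_j=\lambda_i}Y_j^2>0$ for all $i=1,\dots,D$. Interpolated conjugate gradients: for $k=0,\dots,d$, $r_k$ is the unique minimiser of $\|p(AA^\top)Y\|^2$ over real polynomials $p$ of degree at most $k$ with $p(0)=1$. For $t=k+\alpha$, $k\in\{0,\dots,d-1\}$, $\alpha\in(0,1]$, $r_t=(1-\alpha)r_k+\alpha r_{k+1}$. For $t\in[0,d]$: $\widehat f_t=A^\dagger(I_D-r_t(AA^\top))Y$ and $R_t^2=\|A\widehat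 f_t-Y\|^2=\|r_t(AA^\top)Y\|^2$. For $t\in(0,d]$, $x_{1,t}$ is the smallest zero of $r_t$ on $[0,\infty)$, $r_{t,<}(x)=r_t(x)\mathbf 1(x<x_{1,t})$ and $r_{t,>}(x)=r_t(x)\mathbf 1(x>x_{1,t})$; $r_{0,<}\equiv1$, $r_{0,>}\equiv0$. Error terms: $S_{t,\lambda}=\|(1-r_{t,<})^{1/2}(AA^\top)\xi\|^2$ and $A_{t,\lambda}=\|r_{t,<}^{1/2}(AA^\top)g\|^2+R_t^2-\|r_{t,<}^{1/2}(AA^\top)Y\|^2$. *)

theory Defs
  imports "HOL-Analysis.Analysis" "HOL-Computational_Algebra.Polynomial"
begin

text \<open>
  A singular value decomposition of a matrix with \<open>CARD('D)\<close> rows that has full row rank: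
  \<open>A = \<Sum>i. \<lambda>\<^sub>i u\<^sub>i v\<^sub>i\<^sup>T\<close>, summed over the \<open>CARD('D)\<close> nonzero singular values, which are
  listed with multiplicity and indexed from 1.
\<close>
definition singular_system ::
    "real^'P^'D \<Rightarrow> (nat \<Rightarrow> real) \<Rightarrow> (nat \<Rightarrow> real^'D) \<Rightarrow> (nat \<Rightarrow> real^'P) \<Rightarrow> bool" where
  "singular_system A lam u v \<longleftrightarrow>
     (\<forall>i\<in>{1..CARD('D)}. 0 < lam i) \<and>
     (\<forall>i\<in>{1..CARD('D)}. \<forall>j\<in>{1..CARD('D)}. i \<le> j \<longrightarrow> lam j \<le> lam i) \<and>
     (\<forall>i\<in>{1..CARD('D)}. \<forall>j\<in>{1..CARD('D)}. u i \<bullet> u j = (if i = j then 1 else 0)) \<and>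
     (\<forall>i\<in>{1..CARD('D)}. \<forall>j\<in>{1..CARD('D)}. v i \<bullet> v j = (if i = j then 1 else 0)) \<and>
     (\<forall>w. A *v w = (\<Sum>i=1..CARD('D). (lam i * (v i \<bullet> w)) *\<^sub>R u i))"

text \<open>The vector \<open>h(A A\<^sup>T) w\<close>, where \<open>lam\<close> and \<open>u\<close> are the singular values and left singular
  vectors of \<open>A\<close>.\<close>
definition spectral_apply ::
    "(nat \<Rightarrow> real) \<Rightarrow> (nat \<Rightarrow> real^'D) \<Rightarrow> (real \<Rightarrow> real) \<Rightarrow> real^'D \<Rightarrow> real^'D" where
  "spectral_apply lam u h w = (\<Sum>i=1..CARD('D). (h ((lam i)\<^sup>2) * (w \<bullet> u i)) *\<^sub>R u i)"

definition pinv :: "real^'P^'D \<Rightarrow> real^'D^'P" where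
  "pinv A = transpose A ** matrix_inv (A ** transpose A)"

definition cg_poly ::
    "(nat \<Rightarrow> real) \<Rightarrow> (nat \<Rightarrow> real^'D) \<Rightarrow> real^'D \<Rightarrow> nat \<Rightarrow> real poly" where
  "cg_poly lam u Y k =
     (THE p. degree p \<le> k \<and> poly p 0 = 1 \<and>
        (\<forall>q. degree q \<le> k \<and> poly q 0 = 1 \<longrightarrow>
           (norm (spectral_apply lam u (poly p) Y))\<^sup>2 \<le> (norm (spectral_apply lam u (poly q) Y))\<^sup>2))"

text \<open>For \<open>t > 0\<close> the decomposition \<open>t = k + a\<close> with \<open>0 < a \<le> 1\<close> is given by \<open>k = \<lceil>t\<rceil> - 1\<close>.\<close>
definition cg_interp ::
    "(nat \<Rightarrow> real) \<Rightarrow> (nat \<Rightarrow> real^'D) \<Rightarrow> real^'D \<Rightarrow> real \<Rightarrow> real poly" where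
  "cg_interp lam u Y t =
     (if t = 0 then cg_poly lam u Y 0
      else let k = nat (\<lceil>t\<rceil> - 1); a = t - real k
           in smult (1 - a) (cg_poly lam u Y k) + smult a (cg_poly lam u Y (k + 1)))"

definition cg_zero ::
    "(nat \<Rightarrow> real) \<Rightarrow> (nat \<Rightarrow> real^'D) \<Rightarrow> real^'D \<Rightarrow> real \<Rightarrow> real" where
  "cg_zero lam u Y t = (LEAST x. 0 \<le> x \<and> poly (cg_interp lam u Y t) x = 0)"

definition cg_below ::
    "(nat \<Rightarrow> real) \<Rightarrow> (nat \<Rightarrow> real^'D) \<Rightarrow> real^'D \<Rightarrow> real \<Rightarrow> real \<Rightarrow> real" where
  "cg_below lam u Y t x =
     (if t = 0 then 1
      else if x < cg_zero lam u Y t then poly (cg_interp lam u Y t) x else 0)"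

definition cg_above ::
    "(nat \<Rightarrow> real) \<Rightarrow> (nat \<Rightarrow> real^'D) \<Rightarrow> real^'D \<Rightarrow> real \<Rightarrow> real \<Rightarrow> real" where
  "cg_above lam u Y t x =
     (if t = 0 then 0
      else if x > cg_zero lam u Y t then poly (cg_interp lam u Y t) x else 0)"

definition cg_estimator ::
    "real^'P^'D \<Rightarrow> (nat \<Rightarrow> real) \<Rightarrow> (nat \<Rightarrow> real^'D) \<Rightarrow> real^'D \<Rightarrow> real \<Rightarrow> real^'P" where
  "cg_estimator A lam u Y t =
     pinv A *v (Y - spectral_apply lam u (poly (cg_interp lam u Y t)) Y)"

definition stochastic_error ::
    "(nat \<Rightarrow> real) \<Rightarrow> (nat \<Rightarrow> real^'D) \<Rightarrow> real^'D \<Rightarrow> real^'D \<Rightarrow> real \<Rightarrow> real" where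
  "stochastic_error lam u Y xi t =
     (norm (spectral_apply lam u (\<lambda>x. sqrt (1 - cg_below lam u Y t x)) xi))\<^sup>2"

definition approximation_error ::
    "real^'P^'D \<Rightarrow> (nat \<Rightarrow> real) \<Rightarrow> (nat \<Rightarrow> real^'D) \<Rightarrow> real^'D \<Rightarrow> real^'D \<Rightarrow> real \<Rightarrow> real" where
  "approximation_error A lam u Y g t =
     (norm (spectral_apply lam u (\<lambda>x. sqrt (cg_below lam u Y t x)) g))\<^sup>2
     + (norm (A *v cg_estimator A lam u Y t - Y))\<^sup>2
     - (norm (spectral_apply lam u (\<lambda>x. sqrt (cg_below lam u Y t x)) Y))\<^sup>2"

end

theory Submission
  imports Defs
begin

text \<open>
  Expand everything in the left singular basis.  Both claims hold coordinate by coordinate as soon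
  as the value \<open>b\<close> of \<open>r\<^bsub>t,<\<^esub>\<close> at each \<open>\<lambda>\<^sub>i\<^sup>2\<close> lies in \<open>[0, 1]\<close>: the identity is a rearrangement, and
  the inequality reduces to the nonnegativity of \<open>(b g\<^sub>i - (1 - b) \<xi>\<^sub>i)\<^sup>2\<close> below the first zero and of
  \<open>(\<xi>\<^sub>i + r\<^sub>t Y\<^sub>i)\<^sup>2\<close> above it.  The bound on \<open>b\<close> holds because \<open>r\<^sub>t\<close> is a product of factors
  \<open>1 - x / y\<close> with \<open>y > 0\<close>.  Indeed the minimality of \<open>r\<^sub>k\<close> makes it orthogonal to all polynomials of
  degree below \<open>k\<close> with respect to the weights \<open>\<lambda>\<^sub>i\<^sup>2 Y\<^sub>i\<^sup>2\<close> at the nodes \<open>\<lambda>\<^sub>i\<^sup>2\<close>; hence so is \<open>r\<^sub>t\<close> for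
  \<open>k < t \<le> k + 1\<close>, and a polynomial with this orthogonality has at least \<open>k\<close> positive zeros.
  Since \<open>r\<^sub>t\<close> has degree \<open>k + 1\<close>, the sign of its leading coefficient makes the last zero positive too.
\<close>

section \<open>Polynomials with positive zeros\<close>

text \<open>Zeros are kept in a list, so its length counts them with multiplicity. The factors are
  normalised to value 1 at 0, matching the constraint p(0) = 1.\<close>

definition root_prod :: "real list \<Rightarrow> real poly" where
  "root_prod ys = (\<Prod>y\<leftarrow>ys. [:1, - 1 / y:])"

lemma root_prod_simps [simp]:
  "root_prod [] = 1" "root_prod (y # ys) = [:1, - 1 / y:] * root_prod ys"
  by (simp_all add: root_prod_def)

lemma poly_root_prod: "poly (root_prod ys) x = (\<Prod>y\<leftarrow>ys. 1 - x / y)"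
  by (induction ys) (simp_all del: mult_pCons_left)

text \<open>Every factor contributes the negative leading coefficient -1/y, so the sign records the
  parity of the number of zeros. This parity is what later excludes a missing zero.\<close>

lemma lead_coeff_root_prod:
  assumes "\<forall>y\<in>set ys. 0 < y"
  shows "degree (root_prod ys) = length ys \<and> 0 < (-1) ^ length ys * lead_coeff (root_prod ys)"
  using assms
proof (induction ys)
  case (Cons y ys)
  then have IH: "degree (root_prod ys) = length ys"
      "0 < (-1) ^ length ys * lead_coeff (root_prod ys)" and y: "0 < y"
    by auto
  have nz: "root_prod ys \<noteq> 0" using IH(2) by auto
  have deg: "degree (root_prod (y # ys)) = length (y # ys)"
    using y nz IH(1) by (simp add: degree_mult_eq del: mult_pCons_left)
  have "lead_coeff (root_prod (y # ys)) = (- 1 / y) * lead_coeff (root_prod ys)"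
    unfolding root_prod_simps lead_coeff_mult using y by simp
  then have "(-1) ^ length (y # ys) * lead_coeff (root_prod (y # ys))
      = ((-1) ^ length ys * lead_coeff (root_prod ys)) / y"
    by simp
  with deg IH(2) y show ?case by (metis divide_pos_pos)
qed simp

lemma poly_root_prod_eq_0_iff:
  assumes "\<forall>y\<in>set ys. 0 < y"
  shows "poly (root_prod ys) x = 0 \<longleftrightarrow> x \<in> set ys"
  using assms by (induction ys) (auto simp: poly_root_prod field_simps)

lemma poly_root_prod_bounds:
  assumes "\<forall>y\<in>set ys. 0 < y \<and> x < y" and "0 \<le> x"
  shows "0 \<le> poly (root_prod ys) x \<and> poly (root_prod ys) x \<le> 1"
  using assms(1)
proof (induction ys)
  case (Cons y ys)
  then have "0 \<le> 1 - x / y" "1 - x / y \<le> 1" using assms(2) by (auto simp: field_simps)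
  moreover have "poly (root_prod (y # ys)) x = (1 - x / y) * poly (root_prod ys) x"
    by (simp only: poly_root_prod list.map prod_list.Cons)
  ultimately show ?case using Cons by (simp add: mult_le_one del: root_prod_simps)
qed simp

text \<open>Positive zeros are split off one at a time, by induction on the degree. Once none is
  left, the value 1 at 0 and the intermediate value theorem force positivity on the positive
  half-line.\<close>

lemma positive_root_factorization:
  fixes p :: "real poly"
  assumes "poly p 0 = 1"
  obtains ys s where "\<forall>y\<in>set ys. 0 < y" "p = root_prod ys * s"
    "poly s 0 = 1" "\<And>x. 0 < x \<Longrightarrow> 0 < poly s x"
proof -
  have "\<exists>ys s. (\<forall>y\<in>set ys. 0 < y) \<and> p = root_prod ys * s \<and> poly s 0 = 1
          \<and> (\<forall>x>0. 0 < poly s x)"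
    using assms
  proof (induction "degree p" arbitrary: p rule: less_induct)
    case less
    show ?case
    proof (cases "\<exists>y>0. poly p y = 0")
      case True
      then obtain y q where y: "0 < y" and q: "p = [:- y, 1:] * q"
        by (metis poly_eq_0_iff_dvd dvdE)
      \<comment> \<open>The factor x - y equals -y (1 - x/y); moving -y into the quotient gives
        \<open>q'\<close> the value 1 at 0 again, as the induction hypothesis demands.\<close>
      define q' where "q' = smult (- y) q"
      have pq: "p = [:1, - 1 / y:] * q'"
      proof -
        have "[:1, - 1 / y:] * q' = smult (- y) [:1, - 1 / y:] * q"
          by (simp only: q'_def mult_smult_left mult_smult_right)
        then show ?thesis using y q by simp
      qed
      have "q' \<noteq> 0" using less.prems pq by auto
      then have "degree p = Suc (degree q')"
        using y unfolding pq by (simp add: degree_mult_eq del: mult_pCons_left)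
      moreover have "poly q' 0 = 1" using less.prems pq by simp
      ultimately obtain ys s where ys: "\<forall>y\<in>set ys. 0 < y" "q' = root_prod ys * s"
        "poly s 0 = 1" "\<forall>x>0. 0 < poly s x"
        using less.hyps[of q'] by auto
      have "p = root_prod (y # ys) * s"
        unfolding pq ys(2) root_prod_simps by (simp only: mult.assoc)
      with ys y show ?thesis by (intro exI[of _ "y # ys"] exI[of _ s]) auto
    next
      case False
      have "0 < poly p x" if "0 < x" for x
        using poly_IVT_neg[OF that, of p] less.prems False that
        by (metis linorder_neqE_linordered_idom zero_less_one)
      then show ?thesis using less.prems by (intro exI[of _ "[]"] exI[of _ p]) auto
    qed
  qed
  then show ?thesis using that by blast
qed

text \<open>Otherwise -s would have a positive leading coefficient and be positive for large
  arguments.\<close>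

lemma lead_coeff_pos_if_pos:
  fixes s :: "real poly"
  assumes "\<And>x. 0 < x \<Longrightarrow> 0 < poly s x"
  shows "0 < lead_coeff s"
proof (rule ccontr)
  assume "\<not> 0 < lead_coeff s"
  moreover have "s \<noteq> 0" using assms[of 1] by auto
  ultimately have "0 < lead_coeff (- s)" by (simp add: less_le)
  then obtain n where n: "\<And>x. n \<le> x \<Longrightarrow> lead_coeff (- s) \<le> poly (- s) x"
    using poly_pinfty_gt_lc by blast
  from n[of "max n 1"] \<open>0 < lead_coeff (- s)\<close> assms[of "max n 1"] show False
    by (simp add: less_max_iff_disj)
qed

section \<open>Spectral calculus and orthogonality of the residual polynomials\<close>

locale positive_spectrum =
  fixes lam :: "nat \<Rightarrow> real" and u :: "nat \<Rightarrow> real^'D"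
  assumes lam_pos: "\<And>i. i \<in> {1..CARD('D)} \<Longrightarrow> 0 < lam i"
    and orthonormal: "\<And>i j. i \<in> {1..CARD('D)} \<Longrightarrow> j \<in> {1..CARD('D)} \<Longrightarrow>
      u i \<bullet> u j = (if i = j then 1 else 0)"
begin

lemma inner_spectral_apply_basis:
  assumes "i \<in> {1..CARD('D)}"
  shows "spectral_apply lam u h w \<bullet> u i = h ((lam i)\<^sup>2) * (w \<bullet> u i)"
proof -
  have "spectral_apply lam u h w \<bullet> u i
      = (\<Sum>j=1..CARD('D). (h ((lam j)\<^sup>2) * (w \<bullet> u j)) * (u j \<bullet> u i))"
    by (simp add: spectral_apply_def inner_sum_left)
  also have "\<dots> = (\<Sum>j=1..CARD('D). if j = i then h ((lam j)\<^sup>2) * (w \<bullet> u j) else 0)"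
    using assms by (intro sum.cong) (auto simp: orthonormal)
  finally show ?thesis using assms by simp
qed

text \<open>Orthonormal vectors are independent, and there are as many as the dimension, so they
  span. The remainder \<open>z\<close> is orthogonal to all of them, hence to itself.\<close>

lemma basis_expansion: "w = (\<Sum>i=1..CARD('D). (w \<bullet> u i) *\<^sub>R u i)"
proof -
  have inj: "inj_on u {1..CARD('D)}"
    by (rule inj_onI) (metis orthonormal zero_neq_one)
  have "pairwise orthogonal (u ` {1..CARD('D)})"
    by (auto simp: pairwise_def orthogonal_def orthonormal)
  moreover have "0 \<notin> u ` {1..CARD('D)}"
    using orthonormal by (metis imageE inner_zero_left zero_neq_one)
  ultimately have "independent (u ` {1..CARD('D)})"
    by (rule pairwise_orthogonal_independent)
  then have "UNIV \<subseteq> span (u ` {1..CARD('D)})"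
    by (intro card_ge_dim_independent) (simp_all add: card_image[OF inj] del: One_nat_def)
  then have span: "span (u ` {1..CARD('D)}) = UNIV" by auto
  define z where "z = w - spectral_apply lam u (\<lambda>_. 1) w"
  have "z \<bullet> u i = 0" if "i \<in> {1..CARD('D)}" for i
    using inner_spectral_apply_basis[OF that, of "\<lambda>_. 1" w] by (simp add: z_def inner_diff_left)
  then have "orthogonal z x" if "x \<in> u ` {1..CARD('D)}" for x
    using that by (auto simp: orthogonal_def)
  then have "orthogonal z z"
    using orthogonal_to_span[of z "u ` {1..CARD('D)}" z] span by auto
  then have "z = 0" by (simp add: orthogonal_def)
  then show ?thesis by (simp add: z_def spectral_apply_def)
qed

lemma inner_basis_expansion: "w \<bullet> z = (\<Sum>i=1..CARD('D). (w \<bullet> u i) * (z \<bullet> u i))"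
  by (subst basis_expansion[of w])
    (simp only: inner_sum_left inner_scaleR_left inner_commute[of z])

lemma norm_basis_expansion: "(norm w)\<^sup>2 = (\<Sum>i=1..CARD('D). (w \<bullet> u i)\<^sup>2)"
  unfolding power2_norm_eq_inner by (subst inner_basis_expansion) (simp add: power2_eq_square)

lemma norm_spectral_apply:
  "(norm (spectral_apply lam u h w))\<^sup>2 = (\<Sum>i=1..CARD('D). (h ((lam i)\<^sup>2) * (w \<bullet> u i))\<^sup>2)"
  by (simp add: norm_basis_expansion inner_spectral_apply_basis)

lemma inner_spectral_apply:
  "w \<bullet> spectral_apply lam u h z = (\<Sum>i=1..CARD('D). (w \<bullet> u i) * (h ((lam i)\<^sup>2) * (z \<bullet> u i)))"
  by (subst inner_basis_expansion) (simp add: inner_spectral_apply_basis)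

lemma inner_spectral_apply_both:
  "spectral_apply lam u h w \<bullet> spectral_apply lam u h' w
    = (\<Sum>i=1..CARD('D). h ((lam i)\<^sup>2) * h' ((lam i)\<^sup>2) * (w \<bullet> u i)\<^sup>2)"
  unfolding inner_spectral_apply
  by (intro sum.cong) (simp_all add: inner_spectral_apply_basis power2_eq_square)

lemma spectral_apply_poly_add:
  "spectral_apply lam u (poly (p + q)) w
    = spectral_apply lam u (poly p) w + spectral_apply lam u (poly q) w"
  by (simp add: spectral_apply_def distrib_right scaleR_add_left sum.distrib)

lemma spectral_apply_poly_smult:
  "spectral_apply lam u (poly (smult c p)) w = c *\<^sub>R spectral_apply lam u (poly p) w"
  by (simp add: spectral_apply_def scaleR_sum_right mult.assoc)

lemma spectral_apply_poly_one: "spectral_apply lam u (poly 1) w = w"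
  using basis_expansion[of w] by (simp add: spectral_apply_def)

end

section \<open>Residual polynomials and the location of their zeros\<close>

locale noisy_spectrum = positive_spectrum lam u for lam and u :: "nat \<Rightarrow> real^'D" +
  fixes Y :: "real^'D"
  assumes Y_pos: "\<And>i. i \<in> {1..CARD('D)} \<Longrightarrow>
      0 < (\<Sum>j\<in>{j\<in>{1..CARD('D)}. lam j = lam i}. (Y \<bullet> u j)\<^sup>2)"
begin

lemma ex_nonzero_coord:
  assumes "i \<in> {1..CARD('D)}"
  obtains j where "j \<in> {1..CARD('D)}" "lam j = lam i" "Y \<bullet> u j \<noteq> 0"
proof -
  let ?J = "{j\<in>{1..CARD('D)}. lam j = lam i}"
  have "(\<Sum>j\<in>?J. (Y \<bullet> u j)\<^sup>2) \<noteq> 0" using Y_pos[OF assms] by (rule less_imp_neq[symmetric])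
  then obtain j where "j \<in> ?J" "(Y \<bullet> u j)\<^sup>2 \<noteq> 0" by (rule sum.not_neutral_contains_not_neutral)
  then show ?thesis using that[of j] by simp
qed

text \<open>An index with vanishing coordinate of \<open>Y\<close> says nothing about q, but some
  index with the same singular value, hence the same node, has a nonzero coordinate.\<close>

lemma vanishes_at_nodes:
  assumes "\<And>i. i \<in> {1..CARD('D)} \<Longrightarrow> poly q ((lam i)\<^sup>2) * (Y \<bullet> u i) = 0"
    and "i \<in> {1..CARD('D)}"
  shows "poly q ((lam i)\<^sup>2) = 0"
proof -
  obtain j where "j \<in> {1..CARD('D)}" "lam j = lam i" "Y \<bullet> u j \<noteq> 0"
    using assms(2) by (rule ex_nonzero_coord)
  then show ?thesis using assms(1)[of j] by simp
qed

lemma card_nodes: "card ((\<lambda>i. (lam i)\<^sup>2) ` {1..CARD('D)}) = card (lam ` {1..CARD('D)})"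
proof -
  have "inj_on (\<lambda>x. x\<^sup>2) (lam ` {1..CARD('D)})"
    by (rule inj_onI, rule power2_eq_imp_eq) (auto simp: less_imp_le lam_pos)
  from card_image[OF this] show ?thesis by (simp add: image_image)
qed

lemma card_singular_values_le_degree:
  assumes "q \<noteq> 0" and "\<And>i. i \<in> {1..CARD('D)} \<Longrightarrow> poly q ((lam i)\<^sup>2) = 0"
  shows "card (lam ` {1..CARD('D)}) \<le> degree q"
proof -
  have "(\<lambda>i. (lam i)\<^sup>2) ` {1..CARD('D)} \<subseteq> {x. poly q x = 0}" using assms(2) by auto
  then have "card (lam ` {1..CARD('D)}) \<le> card {x. poly q x = 0}"
    unfolding card_nodes[symmetric] using assms(1) by (intro card_mono poly_roots_finite)
  then show ?thesis using card_poly_roots_bound[OF assms(1)] by simp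
qed

text \<open>The polynomials x q(x), written \<open>pCons 0 q\<close>, are the directions in which p
  can vary with p(0) fixed, so these are the normal equations of the minimisation. The factor x
  produces the weight lam_i^2. For m = 0 the condition is void.\<close>

definition residual_orthogonal :: "nat \<Rightarrow> real poly \<Rightarrow> bool" where
  "residual_orthogonal m p \<longleftrightarrow> (\<forall>q. degree q < m \<longrightarrow>
     spectral_apply lam u (poly p) Y \<bullet> spectral_apply lam u (poly (pCons 0 q)) Y = 0)"

lemma residual_orthogonal_combination:
  assumes "residual_orthogonal m p" "residual_orthogonal m q"
  shows "residual_orthogonal m (smult a p + smult b q)"
  unfolding residual_orthogonal_def spectral_apply_poly_add spectral_apply_poly_smult
    inner_add_left inner_scaleR_left
  using assms[unfolded residual_orthogonal_def] by simp

lemma residual_orthogonal_mono: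
  assumes "residual_orthogonal n p" "m \<le> n"
  shows "residual_orthogonal m p"
  using assms unfolding residual_orthogonal_def by (meson less_le_trans)

text \<open>If \<open>root_prod ys\<close> had degree below \<open>m\<close>, it could be used as a test polynomial, and the
  orthogonality sum would then consist of nonnegative terms.\<close>

lemma residual_orthogonal_length_roots:
  assumes orth: "residual_orthogonal m (root_prod ys * s)" and "m \<le> card (lam ` {1..CARD('D)})"
    and ys: "\<forall>y\<in>set ys. 0 < y" and s: "\<And>x. 0 < x \<Longrightarrow> 0 < poly s x"
  shows "m \<le> length ys"
proof (rule ccontr)
  assume less: "\<not> m \<le> length ys"
  let ?q = "root_prod ys"
  have deg: "degree ?q = length ys" and nz: "?q \<noteq> 0"
    using lead_coeff_root_prod[OF ys] by auto
  have "(\<Sum>i=1..CARD('D). poly s ((lam i)\<^sup>2) * (lam i)\<^sup>2 * (poly ?q ((lam i)\<^sup>2) * (Y \<bullet> u i))\<^sup>2) = 0"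
    (is "?S = 0")
  proof -
    have "?S = spectral_apply lam u (poly (?q * s)) Y \<bullet> spectral_apply lam u (poly (pCons 0 ?q)) Y"
      unfolding inner_spectral_apply_both by (intro sum.cong) (simp_all add: power2_eq_square)
    also have "\<dots> = 0" using orth less deg unfolding residual_orthogonal_def by simp
    finally show ?thesis .
  qed
  note sum_zero = this
  have nonneg: "0 \<le> poly s ((lam i)\<^sup>2) * (lam i)\<^sup>2 * (poly ?q ((lam i)\<^sup>2) * (Y \<bullet> u i))\<^sup>2"
    if "i \<in> {1..CARD('D)}" for i
    using s[of "(lam i)\<^sup>2"] lam_pos[OF that] by simp
  have zero: "poly s ((lam i)\<^sup>2) * (lam i)\<^sup>2 * (poly ?q ((lam i)\<^sup>2) * (Y \<bullet> u i))\<^sup>2 = 0"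
    if "i \<in> {1..CARD('D)}" for i
    by (rule sum_nonneg_0[OF finite_atLeastAtMost nonneg sum_zero that])
  have "poly ?q ((lam i)\<^sup>2) * (Y \<bullet> u i) = 0" if "i \<in> {1..CARD('D)}" for i
    using zero[OF that] s[of "(lam i)\<^sup>2"] lam_pos[OF that] by auto
  then have "card (lam ` {1..CARD('D)}) \<le> degree ?q"
    by (intro card_singular_values_le_degree nz vanishes_at_nodes)
  with deg less assms(2) show False by simp
qed

text \<open>Project \<open>Y\<close> orthogonally onto the Krylov space \<open>W\<close>. The
  projection has the form x q(x) applied to \<open>Y\<close>, so the remainder comes from 1 - x
  q(x).\<close>

lemma ex_residual_orthogonal:
  obtains p where "degree p \<le> k" "poly p 0 = 1" "residual_orthogonal k p"
proof -
  \<comment> \<open>The alternative \<open>q = 0\<close> keeps 0 in \<open>W\<close> when k = 0,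
    since the zero polynomial has degree 0.\<close>
  define W where "W = {spectral_apply lam u (poly (pCons 0 q)) Y | q. q = 0 \<or> degree q < k}"
  have "subspace W"
    unfolding subspace_def
  proof (intro conjI ballI allI)
    show "0 \<in> W"
      unfolding W_def by (rule CollectI, rule exI[of _ 0]) (simp add: spectral_apply_def)
  next
    fix x y assume "x \<in> W" "y \<in> W"
    then obtain p q where p: "p = 0 \<or> degree p < k" "x = spectral_apply lam u (poly (pCons 0 p)) Y"
      and q: "q = 0 \<or> degree q < k" "y = spectral_apply lam u (poly (pCons 0 q)) Y"
      unfolding W_def by blast
    have "x + y = spectral_apply lam u (poly (pCons 0 (p + q))) Y"
      unfolding p q spectral_apply_poly_add[symmetric] by simp
    moreover have "p + q = 0 \<or> degree (p + q) < k"
      using p(1) q(1) degree_add_less by auto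
    ultimately show "x + y \<in> W" unfolding W_def by blast
  next
    fix c x assume "x \<in> W"
    then obtain p where p: "p = 0 \<or> degree p < k" "x = spectral_apply lam u (poly (pCons 0 p)) Y"
      unfolding W_def by blast
    have "c *\<^sub>R x = spectral_apply lam u (poly (pCons 0 (smult c p))) Y"
      unfolding p spectral_apply_poly_smult[symmetric] by simp
    moreover have "smult c p = 0 \<or> degree (smult c p) < k"
      using p(1) degree_smult_le[of c p] by auto
    ultimately show "c *\<^sub>R x \<in> W" unfolding W_def by blast
  qed
  then have span: "span W = W" by simp
  obtain w z where "w \<in> span W" and z: "\<And>x. x \<in> span W \<Longrightarrow> orthogonal z x" and "Y = w + z"
    using orthogonal_subspace_decomp_exists[of W Y] by blast
  then have "w \<in> W" by (simp only: span)
  then obtain q where q: "q = 0 \<or> degree q < k" "w = spectral_apply lam u (poly (pCons 0 q)) Y"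
    unfolding W_def by blast
  let ?p = "1 - pCons 0 q"
  have "spectral_apply lam u (poly ?p) Y = z"
  proof -
    have "spectral_apply lam u (poly ?p) Y + w = Y"
      unfolding q(2) spectral_apply_poly_add[symmetric] by (simp add: spectral_apply_poly_one)
    then show ?thesis using \<open>Y = w + z\<close> by (simp add: algebra_simps)
  qed
  moreover have "z \<bullet> x = 0" if "x \<in> W" for x
    using z[of x] that by (simp only: span orthogonal_def)
  ultimately have "residual_orthogonal k ?p"
    unfolding residual_orthogonal_def W_def by blast
  moreover have "degree ?p \<le> k"
    using q(1) by (intro degree_diff_le) (auto simp: degree_pCons_eq_if)
  ultimately show ?thesis using that[of ?p] by simp
qed

text \<open>The difference q - p vanishes at 0, so it is x h(x) with h of degree below k or zero, a
  direction orthogonal to the residual of p. This yields both minimality and uniqueness.\<close>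

lemma residual_orthogonal_pythagoras:
  assumes p: "degree p \<le> k" "poly p 0 = 1" "residual_orthogonal k p"
    and q: "degree q \<le> k" "poly q 0 = 1"
  shows "(norm (spectral_apply lam u (poly q) Y))\<^sup>2 = (norm (spectral_apply lam u (poly p) Y))\<^sup>2
    + (norm (spectral_apply lam u (poly (q - p)) Y))\<^sup>2"
proof -
  obtain h where h: "q - p = pCons 0 h"
    using p(2) q(2) by (cases "q - p") (metis diff_self poly_0_coeff_0 coeff_pCons_0 poly_diff)
  have "spectral_apply lam u (poly p) Y \<bullet> spectral_apply lam u (poly (q - p)) Y = 0"
  proof (cases "h = 0")
    case True
    then show ?thesis unfolding h by (simp add: spectral_apply_def)
  next
    case False
    have "degree (q - p) \<le> k" using p(1) q(1) by (rule degree_diff_le[rotated])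
    with False have "degree h < k" unfolding h by simp
    then show ?thesis using p(3) unfolding h residual_orthogonal_def by blast
  qed
  moreover have "spectral_apply lam u (poly q) Y
      = spectral_apply lam u (poly p) Y + spectral_apply lam u (poly (q - p)) Y"
    unfolding spectral_apply_poly_add[symmetric] by simp
  ultimately show ?thesis
    by (simp add: power2_norm_eq_inner inner_add_left inner_add_right inner_commute)
qed

text \<open>This justifies the definite description in \<open>cg_poly\<close>: the orthogonal p is a
  minimiser, and the bound on k makes it the only one.\<close>

lemma cg_poly_residual_orthogonal:
  assumes "k \<le> card (lam ` {1..CARD('D)})"
  shows "degree (cg_poly lam u Y k) \<le> k \<and> poly (cg_poly lam u Y k) 0 = 1
    \<and> residual_orthogonal k (cg_poly lam u Y k)"
proof -
  obtain p where p: "degree p \<le> k" "poly p 0 = 1" "residual_orthogonal k p"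
    by (rule ex_residual_orthogonal)
  have "cg_poly lam u Y k = p"
    unfolding cg_poly_def
  proof (rule the_equality, intro conjI allI impI)
    fix q :: "real poly"
    assume "degree q \<le> k \<and> poly q 0 = 1"
    then show "(norm (spectral_apply lam u (poly p) Y))\<^sup>2 \<le> (norm (spectral_apply lam u (poly q) Y))\<^sup>2"
      using residual_orthogonal_pythagoras[OF p, of q] by simp
  next
    fix q :: "real poly"
    assume "degree q \<le> k \<and> poly q 0 = 1 \<and>
        (\<forall>q'. degree q' \<le> k \<and> poly q' 0 = 1 \<longrightarrow>
           (norm (spectral_apply lam u (poly q) Y))\<^sup>2 \<le> (norm (spectral_apply lam u (poly q') Y))\<^sup>2)"
    then have q: "degree q \<le> k" "poly q 0 = 1"
      and min: "(norm (spectral_apply lam u (poly q) Y))\<^sup>2 \<le> (norm (spectral_apply lam u (poly p) Y))\<^sup>2"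
      using p by auto
    have "(norm (spectral_apply lam u (poly (q - p)) Y))\<^sup>2 = 0"
      using residual_orthogonal_pythagoras[OF p q] min by simp
    then have "poly (q - p) ((lam i)\<^sup>2) * (Y \<bullet> u i) = 0" if "i \<in> {1..CARD('D)}" for i
      using inner_spectral_apply_basis[OF that, of "poly (q - p)" Y] by simp
    then have nodes: "poly (q - p) ((lam i)\<^sup>2) = 0" if "i \<in> {1..CARD('D)}" for i
      using vanishes_at_nodes that by blast
    show "q = p"
    proof (rule ccontr)
      assume "q \<noteq> p"
      \<comment> \<open>Dividing out the zero at 0 leaves a nonzero h of degree at most k - 1 that
        vanishes at all nodes, of which there are at least k.\<close>
      obtain h where h: "q - p = pCons 0 h"
        using p(2) q(2) by (cases "q - p") (metis diff_self poly_0_coeff_0 coeff_pCons_0 poly_diff)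
      have "h \<noteq> 0" using \<open>q \<noteq> p\<close> h by auto
      moreover have "poly h ((lam i)\<^sup>2) = 0" if "i \<in> {1..CARD('D)}" for i
        using nodes[OF that] lam_pos[OF that] unfolding h by simp
      ultimately have "card (lam ` {1..CARD('D)}) \<le> degree h" by (rule card_singular_values_le_degree)
      moreover have "Suc (degree h) \<le> k"
        using degree_diff_le[OF q(1) p(1)] \<open>h \<noteq> 0\<close> unfolding h by simp
      ultimately show False using assms by simp
    qed
  qed (use p in auto)
  with p show ?thesis by simp
qed

text \<open>With at least k positive zeros and degree at most k, all zeros are positive and their
  number fixes the sign.\<close>

lemma cg_poly_lead_coeff:
  assumes "k \<le> card (lam ` {1..CARD('D)})"
  shows "0 < (-1) ^ k * coeff (cg_poly lam u Y k) k"
proof -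
  let ?p = "cg_poly lam u Y k"
  have p: "degree ?p \<le> k" "poly ?p 0 = 1" "residual_orthogonal k ?p"
    using cg_poly_residual_orthogonal[OF assms] by blast+
  obtain ys s where ys: "\<forall>y\<in>set ys. 0 < y" and ps: "?p = root_prod ys * s"
    and s: "poly s 0 = 1" "\<And>x. 0 < x \<Longrightarrow> 0 < poly s x"
    using positive_root_factorization[OF p(2)] by metis
  have len: "k \<le> length ys"
    using residual_orthogonal_length_roots[OF p(3)[unfolded ps] assms ys s(2)] by blast
  have "s \<noteq> 0" "root_prod ys \<noteq> 0" using p(2) ps by auto
  then have deg: "degree ?p = length ys + degree s"
    unfolding ps using lead_coeff_root_prod[OF ys] by (simp add: degree_mult_eq)
  then have "degree ?p = k" "length ys = k" using len p(1) by auto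
  moreover have "lead_coeff ?p = lead_coeff (root_prod ys) * lead_coeff s"
    unfolding ps by (rule lead_coeff_mult)
  ultimately have "(-1) ^ k * coeff ?p k
      = ((-1) ^ length ys * lead_coeff (root_prod ys)) * lead_coeff s"
    by simp
  also have "\<dots> > 0"
    by (rule mult_pos_pos[OF conjunct2[OF lead_coeff_root_prod[OF ys]] lead_coeff_pos_if_pos[OF s(2)]])
  finally show ?thesis .
qed

text \<open>Interpolation preserves orthogonality only up to order k, which accounts for k of the k
  + 1 zeros; the sign of the leading coefficient supplies the last.\<close>

lemma cg_interp_eq_root_prod:
  assumes "0 < t" "t \<le> real (card (lam ` {1..CARD('D)}))"
  obtains ys where "ys \<noteq> []" "\<forall>y\<in>set ys. 0 < y" "cg_interp lam u Y t = root_prod ys"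
proof -
  \<comment> \<open>At an integer t this gives a = 1, never a = 0, so the polynomial of degree k + 1
    always has positive weight.\<close>
  define k a where "k = nat (\<lceil>t\<rceil> - 1)" and "a = t - real k"
  have "real k = of_int \<lceil>t\<rceil> - 1" using assms(1) by (simp add: k_def)
  then have k: "Suc k \<le> card (lam ` {1..CARD('D)})" and a: "0 < a" "a \<le> 1"
    using assms(2) unfolding a_def by linarith+
  let ?r = "cg_poly lam u Y k" and ?r' = "cg_poly lam u Y (Suc k)"
  let ?p = "smult (1 - a) ?r + smult a ?r'"
  have interp: "cg_interp lam u Y t = ?p"
    using assms(1) by (simp add: cg_interp_def Let_def k_def a_def)
  have r: "degree ?r \<le> k" "poly ?r 0 = 1" "residual_orthogonal k ?r"
    using cg_poly_residual_orthogonal[OF Suc_leD[OF k]] by blast+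
  have r': "degree ?r' \<le> Suc k" "poly ?r' 0 = 1" "residual_orthogonal k ?r'"
    using cg_poly_residual_orthogonal[OF k] residual_orthogonal_mono[of "Suc k" _ k] by auto
  have "coeff ?p (Suc k) = a * coeff ?r' (Suc k)"
    using r(1) by (simp add: coeff_eq_0)
  then have "(-1) ^ Suc k * coeff ?p (Suc k) = a * ((-1) ^ Suc k * coeff ?r' (Suc k))"
    by (simp only: mult.left_commute)
  also have "\<dots> > 0" by (intro mult_pos_pos a(1) cg_poly_lead_coeff[OF k])
  finally have lead: "0 < (-1) ^ Suc k * coeff ?p (Suc k)" .
  have "degree ?p \<le> Suc k"
    using r(1) r'(1) by (intro degree_add_le order.trans[OF degree_smult_le]) auto
  moreover have "Suc k \<le> degree ?p" using lead by (intro le_degree) auto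
  ultimately have degp: "degree ?p = Suc k" by simp
  have p0: "poly ?p 0 = 1" using r r' by simp
  obtain ys s where ys: "\<forall>y\<in>set ys. 0 < y" and ps: "?p = root_prod ys * s"
    and s: "poly s 0 = 1" "\<And>x. 0 < x \<Longrightarrow> 0 < poly s x"
    using positive_root_factorization[OF p0] by metis
  have len: "k \<le> length ys"
    using residual_orthogonal_length_roots[of k ys s] ys s(2) k
      residual_orthogonal_combination[OF r(3) r'(3), of "1 - a" a] unfolding ps by simp
  have "s \<noteq> 0" "root_prod ys \<noteq> 0" using p0 ps by auto
  then have "degree (root_prod ys * s) = length ys + degree s"
    using lead_coeff_root_prod[OF ys] by (simp add: degree_mult_eq)
  then have deg: "Suc k = length ys + degree s" using degp ps by (simp only:)
  have "lead_coeff ?p = lead_coeff (root_prod ys) * lead_coeff s"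
    unfolding ps by (rule lead_coeff_mult)
  then have "(-1) ^ length ys * coeff ?p (Suc k)
      = ((-1) ^ length ys * lead_coeff (root_prod ys)) * lead_coeff s"
    using degp by simp
  also have "\<dots> > 0"
    by (rule mult_pos_pos[OF conjunct2[OF lead_coeff_root_prod[OF ys]] lead_coeff_pos_if_pos[OF s(2)]])
  \<comment> \<open>Exactly k positive zeros would give the leading coefficient the sign (-1)^k,
    contrary to \<open>lead\<close>. Hence \<open>s\<close> is constant, and its value at 0 makes it
    1.\<close>
  finally have "length ys \<noteq> k" using lead by auto
  then have len': "length ys = Suc k" and "degree s = 0" using len deg by auto
  then have "s = 1" using s(1) by (auto elim!: degree_eq_zeroE)
  then have "cg_interp lam u Y t = root_prod ys" using interp ps by (simp only: mult_1_right)
  moreover have "ys \<noteq> []" using len' by auto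
  ultimately show ?thesis using that[of ys] ys by blast
qed

lemma cg_below_above:
  assumes "0 \<le> t" "t \<le> real (card (lam ` {1..CARD('D)}))" "0 \<le> x"
  shows "0 \<le> cg_below lam u Y t x \<and> cg_below lam u Y t x \<le> 1
    \<and> poly (cg_interp lam u Y t) x = cg_below lam u Y t x + cg_above lam u Y t x
    \<and> (cg_below lam u Y t x = 0 \<or> cg_above lam u Y t x = 0)"
proof (cases "t = 0")
  case True
  have "degree (cg_poly lam u Y 0) = 0" "poly (cg_poly lam u Y 0) 0 = 1"
    using cg_poly_residual_orthogonal[of 0] by auto
  then have "cg_poly lam u Y 0 = 1" by (auto elim!: degree_eq_zeroE)
  with True show ?thesis by (simp add: cg_interp_def cg_below_def cg_above_def)
next
  case False
  with assms(1) have "0 < t" by simp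
  from this assms(2) obtain ys where ys: "ys \<noteq> []" "\<forall>y\<in>set ys. 0 < y"
    and p: "cg_interp lam u Y t = root_prod ys"
    by (rule cg_interp_eq_root_prod)
  have "Min (set ys) \<in> set ys" using ys(1) by simp
  \<comment> \<open>A least element need not exist over the reals; here it is attained, because the
    zeros form a finite nonempty set.\<close>
  then have "cg_zero lam u Y t = Min (set ys)"
    unfolding cg_zero_def p poly_root_prod_eq_0_iff[OF ys(2)]
    using ys(2) by (intro Least_equality) (auto simp: less_imp_le)
  \<comment> \<open>At the first zero itself both truncations are 0, so the decomposition there
    needs r_t to vanish.\<close>
  moreover from \<open>Min (set ys) \<in> set ys\<close> have "poly (root_prod ys) (Min (set ys)) = 0"
    using poly_root_prod_eq_0_iff[OF ys(2)] by simp
  moreover have "0 \<le> poly (root_prod ys) x \<and> poly (root_prod ys) x \<le> 1" if "x < Min (set ys)"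
    using that ys assms(3) by (intro poly_root_prod_bounds) auto
  ultimately show ?thesis
    using False p by (cases x "Min (set ys)" rule: linorder_cases)
      (auto simp: cg_below_def cg_above_def)
qed

end

section \<open>The error decomposition\<close>

text \<open>If A A^T w = 0 then A^T w = 0, so w is orthogonal to the range of A, which is the whole
  space. Thus A A^T is invertible.\<close>

lemma matrix_mult_pinv:
  fixes A :: "real^'P^'D"
  assumes "rank A = CARD('D)"
  shows "A *v (pinv A *v w) = w"
proof -
  have surj: "surj ((*v) A)" using assms by (simp add: full_rank_surjective)
  have "w = 0" if "(A ** transpose A) *v w = 0" for w
  proof -
    have "(transpose A *v w) \<bullet> (transpose A *v w) = w \<bullet> (A *v (transpose A *v w))"
      by (metis dot_lmul_matrix transpose_matrix_vector transpose_transpose)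
    also have "\<dots> = 0" by (simp only: matrix_vector_mul_assoc that inner_zero_right)
    finally have "transpose A *v w = 0" by (simp only: inner_eq_zero_iff)
    moreover obtain z where "w = A *v z" using surj by (metis surjD)
    ultimately have "w \<bullet> w = 0"
      by (metis dot_lmul_matrix inner_zero_left transpose_matrix_vector)
    then show ?thesis by simp
  qed
  then have "invertible (A ** transpose A)"
    by (metis invertible_left_inverse matrix_left_invertible_ker)
  then have "(A ** transpose A) ** matrix_inv (A ** transpose A) = mat 1"
    unfolding matrix_inv_def invertible_def by (rule someI2_ex) blast
  then show ?thesis
    by (simp add: pinv_def matrix_vector_mul_assoc matrix_mul_assoc)
qed

theorem proposition5p2:
  fixes A :: "real^'P^'D"
    and f :: "real^'P"
    and g xi Y :: "real^'D"
    and lam :: "nat \<Rightarrow> real"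
    and u :: "nat \<Rightarrow> real^'D"
    and v :: "nat \<Rightarrow> real^'P"
    and d :: nat
    and t :: real
  assumes "3 \<le> CARD('D)" and "CARD('D) \<le> CARD('P)"
    and "rank A = CARD('D)"
    and "g = A *v f"
    and "Y = g + xi"
    and "singular_system A lam u v"
    and "d = card (lam ` {1..CARD('D)})"
    and "\<forall>i\<in>{1..CARD('D)}. 0 < (\<Sum>j\<in>{j\<in>{1..CARD('D)}. lam j = lam i}. (Y \<bullet> u j)\<^sup>2)"
    and "0 \<le> t" and "t \<le> real d"
  shows "(norm (A *v (cg_estimator A lam u Y t - f)))\<^sup>2
           = approximation_error A lam u Y g t + stochastic_error lam u Y xi t
             - 2 * (xi \<bullet> spectral_apply lam u (cg_above lam u Y t) Y)
       \<and> approximation_error A lam u Y g t + stochastic_error lam u Y xi t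
             - 2 * (xi \<bullet> spectral_apply lam u (cg_above lam u Y t) Y)
           \<le> 2 * (approximation_error A lam u Y g t + stochastic_error lam u Y xi t)"
proof -
  have lam: "\<forall>i\<in>{1..CARD('D)}. 0 < lam i"
    using assms(6) unfolding singular_system_def by (elim conjE)
  have u: "\<forall>i\<in>{1..CARD('D)}. \<forall>j\<in>{1..CARD('D)}. u i \<bullet> u j = (if i = j then 1 else 0)"
    using assms(6) unfolding singular_system_def by (elim conjE)
  interpret noisy_spectrum lam u Y
  proof
    show "0 < lam i" if "i \<in> {1..CARD('D)}" for i
      using lam that by (rule bspec)
    show "u i \<bullet> u j = (if i = j then 1 else 0)"
      if "i \<in> {1..CARD('D)}" "j \<in> {1..CARD('D)}" for i j
      using bspec[OF u that(1)] that(2) by (rule bspec)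
    show "0 < (\<Sum>j\<in>{j\<in>{1..CARD('D)}. lam j = lam i}. (Y \<bullet> u j)\<^sup>2)"
      if "i \<in> {1..CARD('D)}" for i
      using assms(8) that by (rule bspec)
  qed
  let ?I = "{1..CARD('D)}"
  define r b a where "r i = poly (cg_interp lam u Y t) ((lam i)\<^sup>2)"
    and "b i = cg_below lam u Y t ((lam i)\<^sup>2)" and "a i = cg_above lam u Y t ((lam i)\<^sup>2)" for i
  have b: "0 \<le> b i" "b i \<le> 1" and r: "r i = b i + a i" and ab: "b i = 0 \<or> a i = 0" for i
    using cg_below_above[of t "(lam i)\<^sup>2"] assms(7,9,10) by (auto simp: r_def b_def a_def)
  have Yi: "Y \<bullet> u i = g \<bullet> u i + xi \<bullet> u i" for i
    by (simp add: assms(5) inner_add_left)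
  have AE: "A *v cg_estimator A lam u Y t = Y - spectral_apply lam u (poly (cg_interp lam u Y t)) Y"
    unfolding cg_estimator_def by (rule matrix_mult_pinv[OF assms(3)])
  have loss: "(norm (A *v (cg_estimator A lam u Y t - f)))\<^sup>2
      = (\<Sum>i\<in>?I. (xi \<bullet> u i - r i * (Y \<bullet> u i))\<^sup>2)"
  proof -
    \<comment> \<open>Since A f = g = Y - xi, the data cancel and only the noise minus the CG
      residual remains.\<close>
    have eq: "A *v (cg_estimator A lam u Y t - f)
        = xi - spectral_apply lam u (poly (cg_interp lam u Y t)) Y"
      using AE by (simp add: matrix_vector_mult_diff_distrib assms(4,5))
    show ?thesis
      unfolding eq norm_basis_expansion
      by (intro sum.cong) (simp_all add: inner_diff_left inner_spectral_apply_basis r_def)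
  qed
  have approx: "approximation_error A lam u Y g t
      = (\<Sum>i\<in>?I. b i * (g \<bullet> u i)\<^sup>2 + (r i * (Y \<bullet> u i))\<^sup>2 - b i * (Y \<bullet> u i)\<^sup>2)"
    \<comment> \<open>The bounds on b turn the squared square roots back into b, and likewise into 1
      - b for the stochastic error.\<close>
    using b unfolding approximation_error_def AE
    by (simp add: norm_spectral_apply power_mult_distrib sum.distrib sum_subtractf
        flip: r_def b_def)
  have stoch: "stochastic_error lam u Y xi t = (\<Sum>i\<in>?I. (1 - b i) * (xi \<bullet> u i)\<^sup>2)"
    using b unfolding stochastic_error_def
    by (simp add: norm_spectral_apply power_mult_distrib flip: b_def)
  have cross: "xi \<bullet> spectral_apply lam u (cg_above lam u Y t) Y
      = (\<Sum>i\<in>?I. (xi \<bullet> u i) * (a i * (Y \<bullet> u i)))"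
    by (simp add: inner_spectral_apply a_def)
  have identity: "(norm (A *v (cg_estimator A lam u Y t - f)))\<^sup>2
      = approximation_error A lam u Y g t + stochastic_error lam u Y xi t
        - 2 * (xi \<bullet> spectral_apply lam u (cg_above lam u Y t) Y)"
    unfolding loss approx stoch cross sum_distrib_left sum.distrib[symmetric] sum_subtractf[symmetric]
    by (intro sum.cong refl) (simp add: r Yi power2_eq_square algebra_simps)
  \<comment> \<open>This quantity is the right-hand side of the claimed inequality minus its
    left-hand side.\<close>
  have "0 \<le> approximation_error A lam u Y g t + stochastic_error lam u Y xi t
      + 2 * (xi \<bullet> spectral_apply lam u (cg_above lam u Y t) Y)"
    unfolding approx stoch cross sum_distrib_left sum.distrib[symmetric]
  proof (rule sum_nonneg)
    fix i
    let ?T = "b i * (g \<bullet> u i)\<^sup>2 + (r i * (Y \<bullet> u i))\<^sup>2 - b i * (Y \<bullet> u i)\<^sup>2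
      + (1 - b i) * (xi \<bullet> u i)\<^sup>2 + 2 * ((xi \<bullet> u i) * (a i * (Y \<bullet> u i)))"
    from ab[of i] show "0 \<le> ?T"
    proof
      assume "b i = 0"
      then have "?T = (xi \<bullet> u i + r i * (Y \<bullet> u i))\<^sup>2"
        by (simp add: r power2_eq_square algebra_simps)
      then show ?thesis by simp
    next
      assume "a i = 0"
      then have "?T = (b i * (g \<bullet> u i) - (1 - b i) * (xi \<bullet> u i))\<^sup>2"
        by (simp add: r Yi power2_eq_square algebra_simps)
      then show ?thesis by simp
    qed
  qed
  with identity show ?thesis by simp
qed

end
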